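(* Let $A,B$ be $n\times n$ Hermitian positive definite matrices, and let $P\in\mathbb{C}^{n\times k}$ ($k\le n$) have full column rank. Then $$\lambda_j^{\downarrow}(P^*AP,P^*BP)\le\lambda_j^{\downarrow}(A,B),\qquad 1\le j\le k.$$
   Context: For Hermitian positive definite $A,B$ of the same size, $\lambda_j^{\downarrow}(A,B)$ denotes the $j$-th largest generalized eigenvalue of the pair $(A,B)$, i.e. the $j$-th largest (with multiplicity) eigenvalue of $B^{-1}A$. $P^*$ is the conjugate transpose of $P$. *)

theory Defs
  imports
    "HOL-Computational_Algebra.Fundamental_Theorem_Algebra"
    "Jordan_Normal_Form.Schur_Decomposition"
    "Jordan_Normal_Form.DL_Rank"
begin

definition hermitian_mat :: "complex mat \<Rightarrow> bool" where
  "hermitian_mat A \<longleftrightarrow> square_mat A \<and> mat_adjoint A = A"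

(* (A *\<^sub>v v) \<bullet>c v is v^* A v.  The order on complex numbers is the one where 0 < z means
   that z is real and positive. *)
definition hpd_mat :: "complex mat \<Rightarrow> bool" where
  "hpd_mat A \<longleftrightarrow> hermitian_mat A \<and>
     (\<forall>v \<in> carrier_vec (dim_row A). v \<noteq> 0\<^sub>v (dim_row A) \<longrightarrow> 0 < (A *\<^sub>v v) \<bullet>c v)"

(* Eigenvalues of B^{-1} A, repeated according to their algebraic multiplicity. *)
definition gen_eigvals :: "complex mat \<Rightarrow> complex mat \<Rightarrow> complex multiset" where
  "gen_eigvals A B = proots (char_poly (the (mat_inverse B) * A))"

(* The index j starts at 1.  Re only changes the type: for positive definite A, B of size n the
   generalized eigenvalues are real and there are n of them (gen_eigvals_real,
   size_gen_eigvals).  Outside that situation, or for j outside {1..n}, the value is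
   meaningless. *)
definition gen_eigval_desc :: "complex mat \<Rightarrow> complex mat \<Rightarrow> nat \<Rightarrow> real" where
  "gen_eigval_desc A B j =
     rev (sorted_list_of_multiset (image_mset Re (gen_eigvals A B))) ! (j - 1)"

lemma hpd_mat_inverse:
  assumes B: "B \<in> carrier_mat n n" and pd: "hpd_mat B"
  shows "the (mat_inverse B) \<in> carrier_mat n n"
    and "B * the (mat_inverse B) = 1\<^sub>m n"
    and "the (mat_inverse B) * B = 1\<^sub>m n"
proof -
  have "det B \<noteq> 0"
  proof
    assume "det B = 0"
    then obtain v where v: "v \<in> carrier_vec n" "v \<noteq> 0\<^sub>v n" "B *\<^sub>v v = 0\<^sub>v n"
      using det_0_iff_vec_prod_zero_field[OF B] by blast
    have "0 < (B *\<^sub>v v) \<bullet>c v"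
      using pd v(1,2) B unfolding hpd_mat_def by auto
    then show False using v by simp
  qed
  then have "B \<in> Units (ring_mat TYPE(complex) n ())"
    by (rule det_non_zero_imp_unit[OF B])
  then obtain C where "mat_inverse B = Some C"
    using mat_inverse(1)[OF B, where b = "()"] by (cases "mat_inverse B") auto
  then show "the (mat_inverse B) \<in> carrier_mat n n" "B * the (mat_inverse B) = 1\<^sub>m n"
    "the (mat_inverse B) * B = 1\<^sub>m n"
    using mat_inverse(2)[OF B] by auto
qed

lemma size_gen_eigvals:
  assumes "A \<in> carrier_mat n n" "B \<in> carrier_mat n n" "hpd_mat B"
  shows "size (gen_eigvals A B) = n"
proof -
  have "the (mat_inverse B) * A \<in> carrier_mat n n"
    using hpd_mat_inverse(1)[OF assms(2,3)] assms(1) by simp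
  then show ?thesis
    unfolding gen_eigvals_def size_proots_complex using degree_monic_char_poly by blast
qed

lemma gen_eigvals_real:
  assumes A: "A \<in> carrier_mat n n" and B: "B \<in> carrier_mat n n"
    and pA: "hpd_mat A" and pB: "hpd_mat B" and z: "z \<in># gen_eigvals A B"
  shows "z = complex_of_real (Re z)"
proof -
  let ?I = "the (mat_inverse B)"
  note I = hpd_mat_inverse[OF B pB]
  have IA: "?I * A \<in> carrier_mat n n" using I(1) A by simp
  have "char_poly (?I * A) \<noteq> 0"
    using degree_monic_char_poly[OF IA] by auto
  then have "poly (char_poly (?I * A)) z = 0"
    using z unfolding gen_eigvals_def by simp
  then have "eigenvalue (?I * A) z"
    using eigenvalue_root_char_poly[OF IA] by blast
  then obtain v where v: "v \<in> carrier_vec n" "v \<noteq> 0\<^sub>v n"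
    and ev: "(?I * A) *\<^sub>v v = z \<cdot>\<^sub>v v"
    using IA unfolding eigenvalue_def eigenvector_def by auto
  have "A *\<^sub>v v = (B * (?I * A)) *\<^sub>v v"
    using I A B by (simp flip: assoc_mult_mat[of B n n ?I n A n])
  also have "\<dots> = B *\<^sub>v (z \<cdot>\<^sub>v v)"
    using assoc_mult_mat_vec[OF B IA v(1)] ev by simp
  also have "\<dots> = z \<cdot>\<^sub>v (B *\<^sub>v v)"
    using mult_mat_vec[OF B v(1)] by simp
  finally have eq: "(A *\<^sub>v v) \<bullet>c v = z * ((B *\<^sub>v v) \<bullet>c v)"
    using B v(1) by simp
  have "0 < (A *\<^sub>v v) \<bullet>c v" "0 < (B *\<^sub>v v) \<bullet>c v"
    using pA pB A B v unfolding hpd_mat_def by auto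
  then have "Im z * Re ((B *\<^sub>v v) \<bullet>c v) = 0" "Re ((B *\<^sub>v v) \<bullet>c v) \<noteq> 0"
    unfolding eq less_complex_def by auto
  then show ?thesis by (simp add: complex_eq_iff)
qed

end

theory Submission
  imports Defs "HOL-Combinatorics.Permutations" "Jordan_Normal_Form.Spectral_Radius"
begin

text \<open>Some basis \<open>Z\<close> of eigenvectors of \<open>B\<inverse>A\<close> satisfies \<open>Z\<^sup>*BZ = I\<close> and makes
  \<open>Z\<^sup>*AZ\<close> diagonal, with the eigenvalues in decreasing order, and likewise some \<open>W\<close> for the
  compressed pair. By counting equations, some nonzero \<open>y\<close> in the span of the first \<open>j\<close> columns
  of \<open>W\<close> has an image \<open>v = Py\<close> whose first \<open>j - 1\<close> coordinates with respect to \<open>Z\<close> vanish.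
  The Rayleigh quotient \<open>v\<^sup>*Av / v\<^sup>*Bv\<close> is then at least the \<open>j\<close>-th eigenvalue of the compressed
  pair and at most that of \<open>(A, B)\<close>.\<close>

section \<open>Adjoints and congruence of Hermitian forms\<close>

lemma mat_adjoint_carrier [simp]: "A \<in> carrier_mat n m \<Longrightarrow> mat_adjoint A \<in> carrier_mat m n"
  unfolding mat_adjoint_def by (auto simp: mat_of_rows_def)

lemma dim_mat_adjoint [simp]:
  "dim_row (mat_adjoint A) = dim_col A" "dim_col (mat_adjoint A) = dim_row A"
  unfolding mat_adjoint_def by (simp_all add: mat_of_rows_def)

lemma mat_adjoint_index:
  "i < dim_col A \<Longrightarrow> j < dim_row A \<Longrightarrow> mat_adjoint A $$ (i, j) = conjugate (A $$ (j, i))"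
  unfolding mat_adjoint_def by (simp add: mat_of_rows_def)

lemma mat_adjoint_cscalar_prod:
  fixes U :: "'a :: conjugatable_field mat"
  assumes U: "U \<in> carrier_mat n m" and a: "a \<in> carrier_vec n" and y: "y \<in> carrier_vec m"
  shows "(mat_adjoint U *\<^sub>v a) \<bullet>c y = a \<bullet>c (U *\<^sub>v y)"
proof -
  have "(mat_adjoint U *\<^sub>v a) \<bullet>c y
      = (\<Sum>i = 0..<m. \<Sum>r = 0..<n. conjugate (U $$ (r, i)) * a $ r * conjugate (y $ i))"
    using assms by (simp add: scalar_prod_def mat_adjoint_def mat_of_rows_def sum_distrib_right)
  also have "\<dots> = (\<Sum>r = 0..<n. \<Sum>i = 0..<m. conjugate (U $$ (r, i)) * a $ r * conjugate (y $ i))"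
    by (rule sum.swap)
  also have "\<dots> = a \<bullet>c (U *\<^sub>v y)"
    using assms by (simp add: scalar_prod_def sum_distrib_left sum_conjugate conjugate_dist_mul ac_simps)
  finally show ?thesis .
qed

text \<open>This identity serves every change of variables below: the compression by
  \<open>P\<close>, the restriction to an orthogonal complement, and the passage to an
  eigenbasis.\<close>

lemma cscalar_prod_congruence:
  fixes U :: "'a :: conjugatable_field mat"
  assumes U: "U \<in> carrier_mat n m" and A: "A \<in> carrier_mat n n"
    and x: "x \<in> carrier_vec m" and y: "y \<in> carrier_vec m"
  shows "((mat_adjoint U * A * U) *\<^sub>v x) \<bullet>c y = (A *\<^sub>v (U *\<^sub>v x)) \<bullet>c (U *\<^sub>v y)"
proof -
  have "(mat_adjoint U * A * U) *\<^sub>v x = mat_adjoint U *\<^sub>v (A *\<^sub>v (U *\<^sub>v x))"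
    using assms mult_carrier_mat[OF mat_adjoint_carrier[OF U] A]
    by (simp add: assoc_mult_mat_vec[of _ m n U m] assoc_mult_mat_vec[of _ m n A n])
  then show ?thesis
    using assms by (simp add: mat_adjoint_cscalar_prod[of U n m])
qed

text \<open>Symmetry of the form passes along a congruence more readily than an identity of entries.
  For the converse, the form at unit vectors returns the entries of \<open>A\<close>.\<close>

lemma hermitian_mat_iff_cscalar_prod:
  assumes A: "A \<in> carrier_mat n n"
  shows "hermitian_mat A \<longleftrightarrow>
    (\<forall>x \<in> carrier_vec n. \<forall>y \<in> carrier_vec n. (A *\<^sub>v x) \<bullet>c y = x \<bullet>c (A *\<^sub>v y))"
proof
  assume "hermitian_mat A"
  then show "\<forall>x \<in> carrier_vec n. \<forall>y \<in> carrier_vec n. (A *\<^sub>v x) \<bullet>c y = x \<bullet>c (A *\<^sub>v y)"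
    using mat_adjoint_cscalar_prod[OF A] unfolding hermitian_mat_def by auto
next
  assume sym: "\<forall>x \<in> carrier_vec n. \<forall>y \<in> carrier_vec n. (A *\<^sub>v x) \<bullet>c y = x \<bullet>c (A *\<^sub>v y)"
  have "mat_adjoint A = A"
  proof (rule eq_matI)
    fix i j assume ij: "i < dim_row A" "j < dim_col A"
    have e: "conjugate (unit_vec n k) = (unit_vec n k :: complex vec)" if "k < n" for k
      by (rule eq_vecI) (auto simp: unit_vec_def)
    have "A $$ (i, j) = (A *\<^sub>v unit_vec n j) \<bullet>c unit_vec n i"
      using A ij by (simp add: e scalar_prod_right_unit)
    also have "\<dots> = unit_vec n j \<bullet>c (A *\<^sub>v unit_vec n i)"
      using sym ij A by simp
    also have "\<dots> = conjugate (A $$ (j, i))"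
      using A ij by (simp add: scalar_prod_left_unit[of _ n] scalar_prod_right_unit)
    finally show "mat_adjoint A $$ (i, j) = A $$ (i, j)"
      using A ij by (simp add: mat_adjoint_index)
  qed (use A mat_adjoint_carrier[OF A] in auto)
  then show "hermitian_mat A" using A unfolding hermitian_mat_def by auto
qed

lemma cscalar_prod_commute:
  fixes v w :: "complex vec"
  assumes "v \<in> carrier_vec n" "w \<in> carrier_vec n"
  shows "v \<bullet>c w = conjugate (w \<bullet>c v)"
  using assms by (simp add: scalar_prod_def sum_conjugate conjugate_dist_mul mult.commute)

lemma hermitian_mat_congruence:
  assumes U: "U \<in> carrier_mat n m" and A: "A \<in> carrier_mat n n" and h: "hermitian_mat A"
  shows "hermitian_mat (mat_adjoint U * A * U)"
proof -
  have C: "mat_adjoint U * A * U \<in> carrier_mat m m"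
    by (intro mult_carrier_mat[of _ m n] mat_adjoint_carrier U A)
  show ?thesis
    unfolding hermitian_mat_iff_cscalar_prod[OF C]
  proof (intro ballI)
    fix x y :: "complex vec" assume x: "x \<in> carrier_vec m" and y: "y \<in> carrier_vec m"
    let ?C = "mat_adjoint U * A * U"
    have "(?C *\<^sub>v x) \<bullet>c y = (U *\<^sub>v x) \<bullet>c (A *\<^sub>v (U *\<^sub>v y))"
      using cscalar_prod_congruence[OF U A x y] h U x y A
      unfolding hermitian_mat_iff_cscalar_prod[OF A] by simp
    also have "\<dots> = conjugate ((?C *\<^sub>v y) \<bullet>c x)"
      using cscalar_prod_congruence[OF U A y x] U A x y cscalar_prod_commute[of "U *\<^sub>v x" n]
      by simp
    also have "\<dots> = x \<bullet>c (?C *\<^sub>v y)"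
      using cscalar_prod_commute[of x m "?C *\<^sub>v y"] C x y by simp
    finally show "(?C *\<^sub>v x) \<bullet>c y = x \<bullet>c (?C *\<^sub>v y)" .
  qed
qed

lemma hpd_mat_congruence:
  assumes U: "U \<in> carrier_mat n m" and A: "A \<in> carrier_mat n n" and h: "hpd_mat A"
    and inj: "\<And>x. x \<in> carrier_vec m \<Longrightarrow> U *\<^sub>v x = 0\<^sub>v n \<Longrightarrow> x = 0\<^sub>v m"
  shows "hpd_mat (mat_adjoint U * A * U)"
proof -
  have C: "mat_adjoint U * A * U \<in> carrier_mat m m"
    by (intro mult_carrier_mat[of _ m n] mat_adjoint_carrier U A)
  have "0 < ((mat_adjoint U * A * U) *\<^sub>v x) \<bullet>c x" if x: "x \<in> carrier_vec m" "x \<noteq> 0\<^sub>v m" for x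
    unfolding cscalar_prod_congruence[OF U A x(1) x(1)]
    using h A mult_mat_vec_carrier[OF U x(1)] x(2) inj[OF x(1)] unfolding hpd_mat_def by auto
  then show ?thesis
    using hermitian_mat_congruence[OF U A] h C unfolding hpd_mat_def by auto
qed

section \<open>Orthogonal complements and full column rank\<close>

text \<open>Any \<open>p\<close> with \<open>b\<^sub>p \<noteq> 0\<close> makes the columns
  \<open>conjugate b\<^sub>p e\<^sub>r - conjugate b\<^sub>r e\<^sub>p\<close>, \<open>r \<noteq> p\<close>, a basis of the complement of \<open>b\<close>.\<close>
lemma ex_orthogonal_complement_basis:
  fixes b :: "complex vec"
  assumes b: "b \<in> carrier_vec (Suc n)" and b0: "b \<noteq> 0\<^sub>v (Suc n)"
  obtains U where "U \<in> carrier_mat (Suc n) n" "mat_adjoint U *\<^sub>v b = 0\<^sub>v n"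
    "\<And>x. x \<in> carrier_vec n \<Longrightarrow> U *\<^sub>v x = 0\<^sub>v (Suc n) \<Longrightarrow> x = 0\<^sub>v n"
proof -
  obtain p where p: "p < Suc n" "b $ p \<noteq> 0"
    using b b0 by (metis carrier_vecD eq_vecI index_zero_vec(1) index_zero_vec(2))
  \<comment> \<open>\<open>insert_index p\<close> enumerates the indices other than
    \<open>p\<close>, so column \<open>i\<close> of \<open>U\<close> belongs to
    \<open>r = s i\<close>.\<close>
  define s where "s = insert_index p"
  have s: "s i < Suc n" "s i \<noteq> p" if "i < n" for i
    using that p unfolding s_def insert_index_def by auto
  have s_inj: "s i = s j \<longleftrightarrow> i = j" for i j
    unfolding s_def insert_index_def by (auto split: if_splits)
  define U where "U = mat (Suc n) n (\<lambda>(r, i). if r = p then - cnj (b $ s i)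
    else if r = s i then cnj (b $ p) else 0)"
  have U: "U \<in> carrier_mat (Suc n) n" unfolding U_def by simp
  have "mat_adjoint U *\<^sub>v b = 0\<^sub>v n"
  proof (rule eq_vecI)
    fix i assume "i < dim_vec (0\<^sub>v n :: complex vec)"
    then have i: "i < n" by simp
    have "(mat_adjoint U *\<^sub>v b) $ i = (\<Sum>r = 0..<Suc n. cnj (U $$ (r, i)) * b $ r)"
      using i U b by (simp add: mat_adjoint_def mat_of_rows_def scalar_prod_def del: sum.op_ivl_Suc)
    also have "\<dots> = (\<Sum>r = 0..<Suc n. (if r = p then - b $ s i * b $ p else 0)
        + (if r = s i then b $ p * b $ s i else 0))"
      by (rule sum.cong) (use i s[OF i] in \<open>auto simp: U_def\<close>)
    also have "\<dots> = 0"
      using s[OF i] p by (simp add: sum.distrib del: sum.op_ivl_Suc)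
    finally show "(mat_adjoint U *\<^sub>v b) $ i = 0\<^sub>v n $ i" using i by simp
  qed (use mat_adjoint_carrier[OF U] in auto)
  moreover have "x = 0\<^sub>v n" if x: "x \<in> carrier_vec n" and Ux: "U *\<^sub>v x = 0\<^sub>v (Suc n)" for x
  proof (rule eq_vecI)
    fix i assume "i < dim_vec (0\<^sub>v n :: complex vec)"
    then have i: "i < n" by simp
    \<comment> \<open>Row \<open>s i\<close> of \<open>U\<close> has \<open>cnj (b $ p)\<close> in
      column \<open>i\<close> and zeros elsewhere, so it isolates \<open>x $ i\<close>.\<close>
    have "0 = (U *\<^sub>v x) $ s i" using Ux s[OF i] by simp
    also have "\<dots> = (\<Sum>k = 0..<n. U $$ (s i, k) * x $ k)"
      using s[OF i] U x by (simp add: scalar_prod_def)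
    also have "\<dots> = (\<Sum>k = 0..<n. if k = i then cnj (b $ p) * x $ i else 0)"
      by (rule sum.cong) (use s[OF i] in \<open>auto simp: U_def s_inj\<close>)
    also have "\<dots> = cnj (b $ p) * x $ i" using i by simp
    finally show "x $ i = 0\<^sub>v n $ i" using p i by simp
  qed (use x in auto)
  ultimately show thesis using that U by blast
qed

text \<open>The rank counts a maximal independent subset of the set of columns, so rank
  \<open>k\<close> forces \<open>k\<close> distinct columns. Distinctness matters because
  independence of the set would not notice a repeated column. Applied to \<open>P\<close>, this
  makes the compressed \<open>B\<close> positive definite.\<close>

lemma rank_eq_dim_col_imp_inj:
  fixes P :: "'a :: field mat"
  assumes P: "P \<in> carrier_mat n k" and rank: "vec_space.rank n P = k"
    and x: "x \<in> carrier_vec k" and Px: "P *\<^sub>v x = 0\<^sub>v n"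
  shows "x = 0\<^sub>v k"
proof -
  interpret vec_space "TYPE('a)" n .
  have "distinct (cols P)"
  proof (rule card_distinct)
    obtain S where S: "maximal S (\<lambda>T. T \<subseteq> set (cols P) \<and> lin_indpt T)"
      using maximal_exists_superset[of "set (cols P)" "\<lambda>T. T \<subseteq> set (cols P) \<and> lin_indpt T" "{}"]
      by (auto simp: finite_lin_indpt2)
    have "k \<le> card (set (cols P))"
      using rank_card_indpt[OF P S] rank S by (metis List.finite_set card_mono maximal_def)
    then show "card (set (cols P)) = length (cols P)"
      using P card_length[of "cols P"] by simp
  qed
  then show ?thesis
    using lin_depI[OF P x _ Px] full_rank_lin_indpt[OF P rank] by blast
qed

section \<open>Simultaneous diagonalization of a Hermitian pencil\<close>

text \<open>Over the complex numbers B^{-1}A has an eigenvalue. Positivity of \<open>B\<close>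
  allows an eigenvector \<open>v\<close> to be scaled to B-norm 1; the eigenvalue is then the value
  of the Hermitian form of \<open>A\<close> at \<open>v\<close>, hence real.\<close>

lemma ex_gen_eigenvector_normalized:
  assumes A: "A \<in> carrier_mat n n" and B: "B \<in> carrier_mat n n"
    and hA: "hermitian_mat A" and hB: "hpd_mat B" and n: "n \<noteq> 0"
  obtains v e where "v \<in> carrier_vec n" "A *\<^sub>v v = complex_of_real e \<cdot>\<^sub>v (B *\<^sub>v v)"
    "(B *\<^sub>v v) \<bullet>c v = 1"
proof -
  let ?I = "the (mat_inverse B)"
  note I = hpd_mat_inverse[OF B hB]
  have IA: "?I * A \<in> carrier_mat n n" using I(1) A by simp
  obtain e where "eigenvalue (?I * A) e"
    using spectrum_non_empty[OF IA] n unfolding spectrum_def by auto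
  then obtain u where u: "u \<in> carrier_vec n" "u \<noteq> 0\<^sub>v n" "(?I * A) *\<^sub>v u = e \<cdot>\<^sub>v u"
    using IA unfolding eigenvalue_def eigenvector_def by auto
  have "A *\<^sub>v u = (B * (?I * A)) *\<^sub>v u"
    using I A B by (simp flip: assoc_mult_mat[of B n n ?I n A n])
  also have "\<dots> = e \<cdot>\<^sub>v (B *\<^sub>v u)"
    using assoc_mult_mat_vec[OF B IA u(1)] u mult_mat_vec[OF B u(1)] by simp
  finally have eu: "A *\<^sub>v u = e \<cdot>\<^sub>v (B *\<^sub>v u)" .
  define b where "b = (B *\<^sub>v u) \<bullet>c u"
  have b: "0 < Re b" "Im b = 0"
    using hB B u unfolding hpd_mat_def b_def less_complex_def by auto
  define s where "s = complex_of_real (1 / sqrt (Re b))"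
  define v where "v = s \<cdot>\<^sub>v u"
  have v: "v \<in> carrier_vec n" using u unfolding v_def by simp
  have Bv: "B *\<^sub>v v = s \<cdot>\<^sub>v (B *\<^sub>v u)"
    using mult_mat_vec[OF B u(1)] unfolding v_def .
  have ev: "A *\<^sub>v v = e \<cdot>\<^sub>v (B *\<^sub>v v)"
    unfolding Bv unfolding v_def mult_mat_vec[OF A u(1)] eu
    by (simp add: smult_smult_assoc mult.commute)
  have "(B *\<^sub>v v) \<bullet>c v = s * cnj s * b"
    using u B unfolding Bv unfolding v_def b_def
    by (simp add: conjugate_smult_vec ac_simps)
  also have "\<dots> = 1"
  proof -
    have "s * cnj s = complex_of_real (1 / Re b)"
      using b by (simp add: s_def flip: of_real_mult)
    moreover have "b = complex_of_real (Re b)" using b by (simp add: complex_eq_iff)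
    ultimately have "s * cnj s * b = complex_of_real (1 / Re b * Re b)"
      by (metis of_real_mult)
    then show ?thesis using b by simp
  qed
  finally have nv: "(B *\<^sub>v v) \<bullet>c v = 1" .
  have "e = (A *\<^sub>v v) \<bullet>c v"
    using nv v B unfolding ev by simp
  also have "\<dots> = cnj ((A *\<^sub>v v) \<bullet>c v)"
    using hA v A cscalar_prod_commute[of v n "A *\<^sub>v v"]
    unfolding hermitian_mat_iff_cscalar_prod[OF A] by simp
  finally have "e = cnj e" using nv v B unfolding ev by simp
  then have "e = complex_of_real (Re e)" by (simp add: complex_eq_iff)
  then show thesis using that v ev nv by metis
qed

text \<open>Deflation by induction on \<open>n\<close>: one normalized eigenvector \<open>v\<close>
  is split off and both matrices are compressed to the orthogonal complement of \<open>B v\<close>.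
  Injectivity of the basis matrix \<open>U\<close> keeps the compressed \<open>B\<close> positive
  definite, so the induction hypothesis applies.\<close>

lemma ex_gen_eigenbasis:
  assumes "A \<in> carrier_mat n n" and "B \<in> carrier_mat n n"
    and "hermitian_mat A" and "hpd_mat B"
  shows "\<exists>z d. (\<forall>i<n. z i \<in> carrier_vec n) \<and>
    (\<forall>i<n. \<forall>j<n. (B *\<^sub>v z i) \<bullet>c z j = (if i = j then 1 else 0) \<and>
      (A *\<^sub>v z i) \<bullet>c z j = (if i = j then complex_of_real (d j) else 0))"
  using assms
proof (induction n arbitrary: A B)
  case 0
  then show ?case by simp
next
  case (Suc n)
  note A = Suc.prems(1) and B = Suc.prems(2) and hA = Suc.prems(3) and hB = Suc.prems(4)
  have hB': "hermitian_mat B" using hB unfolding hpd_mat_def by simp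
  obtain v e where v: "v \<in> carrier_vec (Suc n)" "A *\<^sub>v v = complex_of_real e \<cdot>\<^sub>v (B *\<^sub>v v)"
    "(B *\<^sub>v v) \<bullet>c v = 1"
    using ex_gen_eigenvector_normalized[OF A B hA hB] by blast
  have Bv: "B *\<^sub>v v \<in> carrier_vec (Suc n)" using B v by simp
  have "B *\<^sub>v v \<noteq> 0\<^sub>v (Suc n)" using v by auto
  then obtain U where U: "U \<in> carrier_mat (Suc n) n" "mat_adjoint U *\<^sub>v (B *\<^sub>v v) = 0\<^sub>v n"
    and inj: "\<And>x. x \<in> carrier_vec n \<Longrightarrow> U *\<^sub>v x = 0\<^sub>v (Suc n) \<Longrightarrow> x = 0\<^sub>v n"
    using ex_orthogonal_complement_basis[OF Bv] by blast
  let ?A = "mat_adjoint U * A * U" and ?B = "mat_adjoint U * B * U"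
  have "?A \<in> carrier_mat n n" "?B \<in> carrier_mat n n"
    by (intro mult_carrier_mat[of _ n "Suc n"] mat_adjoint_carrier U A B)+
  from Suc.IH[OF this hermitian_mat_congruence[OF U(1) A hA] hpd_mat_congruence[OF U(1) B hB inj]]
  obtain y d where y: "\<And>i. i < n \<Longrightarrow> y i \<in> carrier_vec n"
    and yB: "\<And>i j. i < n \<Longrightarrow> j < n \<Longrightarrow> (?B *\<^sub>v y i) \<bullet>c y j = (if i = j then 1 else 0)"
    and yA: "\<And>i j. i < n \<Longrightarrow> j < n \<Longrightarrow>
      (?A *\<^sub>v y i) \<bullet>c y j = (if i = j then complex_of_real (d j) else 0)"
    by blast
  have BU: "(B *\<^sub>v v) \<bullet>c (U *\<^sub>v x) = 0" if "x \<in> carrier_vec n" for x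
    using mat_adjoint_cscalar_prod[OF U(1) Bv that] U(2) that by simp
  \<comment> \<open>\<open>A v\<close> is a multiple of \<open>B v\<close>, so the same complement
    is orthogonal to \<open>A v\<close>.\<close>
  have AU: "(A *\<^sub>v v) \<bullet>c (U *\<^sub>v x) = 0" if "x \<in> carrier_vec n" for x
    using BU[OF that] Bv U that unfolding v by simp
  have flip: "(C *\<^sub>v (U *\<^sub>v x)) \<bullet>c v = 0"
    if "hermitian_mat C" "C \<in> carrier_mat (Suc n) (Suc n)" "(C *\<^sub>v v) \<bullet>c (U *\<^sub>v x) = 0"
      "x \<in> carrier_vec n" for C x
    using that v U cscalar_prod_commute[of "U *\<^sub>v x" "Suc n" "C *\<^sub>v v"]
    unfolding hermitian_mat_iff_cscalar_prod[OF that(2)] by simp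
  \<comment> \<open>The eigenvectors of the compressed pair are lifted by \<open>U\<close> and
    shifted by one place, with \<open>v\<close> at index 0.\<close>
  define z where "z i = (case i of 0 \<Rightarrow> v | Suc k \<Rightarrow> U *\<^sub>v y k)" for i
  define d' where "d' i = (case i of 0 \<Rightarrow> e | Suc k \<Rightarrow> d k)" for i
  show ?case
  proof (intro exI[of _ z] exI[of _ d'] conjI allI impI)
    fix i assume "i < Suc n"
    then show "z i \<in> carrier_vec (Suc n)"
      using v U y by (auto simp: z_def split: nat.splits)
  next
    fix i j assume "i < Suc n" "j < Suc n"
    then show "(B *\<^sub>v z i) \<bullet>c z j = (if i = j then 1 else 0)"
      using v BU flip[OF hB' B] y yB cscalar_prod_congruence[OF U(1) B]
      by (auto simp: z_def split: nat.splits)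
  next
    fix i j assume "i < Suc n" "j < Suc n"
    moreover have "(A *\<^sub>v v) \<bullet>c v = complex_of_real e"
      using v B by simp
    ultimately show "(A *\<^sub>v z i) \<bullet>c z j = (if i = j then complex_of_real (d' j) else 0)"
      using AU flip[OF hA A] y yA cscalar_prod_congruence[OF U(1) A]
      by (auto simp: z_def d'_def split: nat.splits)
  qed
qed

text \<open>Sorting the list of values yields the permutation. Having it explicitly allows
  eigenvectors to be reordered together with their eigenvalues.\<close>

lemma ex_permutes_antimono:
  fixes d :: "nat \<Rightarrow> 'a :: linorder"
  obtains p where "p permutes {..<n}" "\<And>i j. i \<le> j \<Longrightarrow> j < n \<Longrightarrow> d (p j) \<le> d (p i)"
proof -
  let ?xs = "map d [0..<n]"
  obtain p where p: "p permutes {..<length ?xs}" "permute_list p ?xs = rev (sort ?xs)"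
    using mset_eq_permutation[of "rev (sort ?xs)" ?xs] by auto
  have "d (p j) \<le> d (p i)" if ij: "i \<le> j" "j < n" for i j
  proof -
    have pn: "p k < n" if "k < n" for k
      using permutes_in_image[OF p(1), of k] that by simp
    have d: "rev (sort ?xs) ! k = d (p k)" if "k < n" for k
      using p that pn[OF that] by (simp flip: p(2) add: permute_list_nth)
    have "rev (sort ?xs) ! j \<le> rev (sort ?xs) ! i"
      using ij by (simp add: rev_nth sorted_nth_mono)
    then show ?thesis using d ij by simp
  qed
  then show thesis using that p by simp
qed

lemma hpd_pencil_diagonalization:
  assumes A: "A \<in> carrier_mat n n" and B: "B \<in> carrier_mat n n"
    and hA: "hermitian_mat A" and hB: "hpd_mat B"
  obtains Z d where "Z \<in> carrier_mat n n" "mat_adjoint Z * B * Z = 1\<^sub>m n"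
    "mat_adjoint Z * A * Z = mat_diag n (\<lambda>i. complex_of_real (d i))"
    "\<And>i j. i \<le> j \<Longrightarrow> j < n \<Longrightarrow> d j \<le> d i"
proof -
  obtain z d where z: "\<And>i. i < n \<Longrightarrow> z i \<in> carrier_vec n"
    and zB: "\<And>i j. i < n \<Longrightarrow> j < n \<Longrightarrow> (B *\<^sub>v z i) \<bullet>c z j = (if i = j then 1 else 0)"
    and zA: "\<And>i j. i < n \<Longrightarrow> j < n \<Longrightarrow>
      (A *\<^sub>v z i) \<bullet>c z j = (if i = j then complex_of_real (d j) else 0)"
    using ex_gen_eigenbasis[OF assms] by blast
  obtain p where p: "p permutes {..<n}" "\<And>i j. i \<le> j \<Longrightarrow> j < n \<Longrightarrow> d (p j) \<le> d (p i)"
    using ex_permutes_antimono[of n d] by blast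
  have pn: "p k < n" if "k < n" for k
    using permutes_in_image[OF p(1), of k] that by simp
  have p_inj: "p i = p j \<longleftrightarrow> i = j" for i j
    using permutes_inj[OF p(1)] by (auto dest: injD)
  define Z where "Z = mat n n (\<lambda>(r, i). z (p i) $ r)"
  have Z: "Z \<in> carrier_mat n n" unfolding Z_def by simp
  have Zu: "Z *\<^sub>v unit_vec n i = z (p i)" if i: "i < n" for i
    using z[OF pn[OF i]] i by (intro eq_vecI) (auto simp: Z_def scalar_prod_right_unit)
  have e: "conjugate (unit_vec n k) = (unit_vec n k :: complex vec)" if "k < n" for k
    by (rule eq_vecI) (auto simp: unit_vec_def)
  \<comment> \<open>The second argument of the form is the conjugated one and corresponds to the
    row, so the indices appear exchanged.\<close>
  have entry: "(mat_adjoint Z * C * Z) $$ (i, j) = (C *\<^sub>v z (p j)) \<bullet>c z (p i)"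
    if C: "C \<in> carrier_mat n n" and ij: "i < n" "j < n" for C i j
  proof -
    have carr: "mat_adjoint Z * C * Z \<in> carrier_mat n n"
      by (intro mult_carrier_mat[of _ n n] mat_adjoint_carrier Z C)
    have "(mat_adjoint Z * C * Z) $$ (i, j) = ((mat_adjoint Z * C * Z) *\<^sub>v unit_vec n j) \<bullet>c unit_vec n i"
      using carr ij by (simp add: e scalar_prod_right_unit del: index_mult_mat)
    then show ?thesis
      using cscalar_prod_congruence[OF Z C, of "unit_vec n j" "unit_vec n i"] ij by (simp add: Zu)
  qed
  have "mat_adjoint Z * B * Z = 1\<^sub>m n"
    by (rule eq_matI) (use Z mat_adjoint_carrier[OF Z] in
      \<open>auto simp: entry[OF B] zB pn p_inj simp del: index_mult_mat(1)\<close>)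
  moreover have "mat_adjoint Z * A * Z = mat_diag n (\<lambda>i. complex_of_real (d (p i)))"
    by (rule eq_matI) (use Z mat_adjoint_carrier[OF Z] in
      \<open>auto simp: mat_diag_def entry[OF A] zA pn p_inj simp del: index_mult_mat(1)\<close>)
  ultimately show thesis using that[of Z "d \<circ> p"] Z p(2) by simp
qed

section \<open>Generalized eigenvalues read off from a diagonalization\<close>

text \<open>From \<open>Z* B Z = I\<close> it follows that \<open>Z* B\<close> inverts
  \<open>Z\<close> and that B^{-1} = \<open>Z Z*\<close>. Hence B^{-1}A is \<open>Z D Z* B\<close>,
  similar to the diagonal matrix \<open>D = Z* A Z\<close>, whose characteristic polynomial shows
  the eigenvalues with multiplicity.\<close>

lemma gen_eigval_desc_diagonalization:
  assumes A: "A \<in> carrier_mat n n" and B: "B \<in> carrier_mat n n" and hB: "hpd_mat B"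
    and Z: "Z \<in> carrier_mat n n" and ZB: "mat_adjoint Z * B * Z = 1\<^sub>m n"
    and ZA: "mat_adjoint Z * A * Z = mat_diag n (\<lambda>i. complex_of_real (d i))"
    and anti: "\<And>i j. i \<le> j \<Longrightarrow> j < n \<Longrightarrow> d j \<le> d i"
    and j: "1 \<le> j" "j \<le> n"
  shows "gen_eigval_desc A B j = d (j - 1)"
proof -
  let ?I = "the (mat_inverse B)" and ?D = "mat_diag n (\<lambda>i. complex_of_real (d i))"
    and ?H = "mat_adjoint Z"
  note I = hpd_mat_inverse[OF B hB]
  have H: "?H \<in> carrier_mat n n" using Z by simp
  have HB: "?H * B \<in> carrier_mat n n" by (rule mult_carrier_mat[OF H B])
  have ZHB: "Z * (?H * B) = 1\<^sub>m n" by (rule mat_mult_left_right_inverse[OF HB Z ZB])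
  have BZ: "B * Z \<in> carrier_mat n n" by (rule mult_carrier_mat[OF B Z])
  have "?H * (B * Z) = 1\<^sub>m n" using ZB H B Z by (simp add: assoc_mult_mat[of _ n n _ n _ n])
  then have BZH: "B * Z * ?H = 1\<^sub>m n" by (rule mat_mult_left_right_inverse[OF H BZ])
  have ZH: "Z * ?H = ?I"
  proof -
    have "Z * ?H = ?I * B * (Z * ?H)" using I(3) left_mult_one_mat[OF mult_carrier_mat[OF Z H]] by simp
    also have "\<dots> = ?I * (B * (Z * ?H))"
      by (rule assoc_mult_mat[OF I(1) B mult_carrier_mat[OF Z H]])
    also have "B * (Z * ?H) = B * Z * ?H" by (rule assoc_mult_mat[OF B Z H, symmetric])
    finally show ?thesis using BZH I by simp
  qed
  have "similar_mat (?I * A) ?D"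
  proof (rule similar_matI[OF _ ZHB ZB])
    show "{?I * A, ?D, Z, ?H * B} \<subseteq> carrier_mat n n" using I A Z HB by auto
    have HAZ: "?H * A * Z \<in> carrier_mat n n" by (intro mult_carrier_mat[of _ n n] H A Z)
    have "Z * ?D * (?H * B) = (Z * ?H) * A * (Z * (?H * B))"
      unfolding ZA[symmetric] using Z H A HB HAZ
      by (simp add: assoc_mult_mat[of _ n n _ n _ n] mult_carrier_mat[of _ n n])
    then show "?I * A = Z * ?D * (?H * B)" using ZH ZHB I A by simp
  qed
  then have "char_poly (?I * A) = char_poly ?D" by (rule char_poly_similar)
  also have "\<dots> = (\<Prod>a\<leftarrow>diag_mat ?D. [:- a, 1:])"
    by (rule char_poly_upper_triangular[of _ n]) (auto simp: mat_diag_def)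
  also have "diag_mat ?D = map (\<lambda>i. complex_of_real (d i)) [0..<n]"
    by (auto simp: diag_mat_def mat_diag_def)
  finally have cp: "char_poly (?I * A) = (\<Prod>i\<leftarrow>[0..<n]. [:- complex_of_real (d i), 1:])"
    by (simp add: o_def)
  \<comment> \<open>Stated for an arbitrary index list so that induction applies; the instance
    needed is \<open>[0..<n]\<close>.\<close>
  have "proots (\<Prod>i\<leftarrow>is. [:- complex_of_real (d i), 1:]) = mset (map (\<lambda>i. complex_of_real (d i)) is)"
    for "is" :: "nat list"
  proof (induction "is")
    case (Cons a "is")
    have "(\<Prod>i\<leftarrow>is. [:- complex_of_real (d i), 1:]) \<noteq> 0"
      by (auto simp: prod_list_zero_iff)
    then show ?case using Cons by (simp add: proots_mult del: mult_pCons_left)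
  qed simp
  then have "image_mset Re (gen_eigvals A B) = mset (rev (map d [0..<n]))"
    unfolding gen_eigvals_def cp by (simp add: o_def image_mset.compositionality)
  \<comment> \<open>Since \<open>d\<close> decreases, its reversed list is the ascending one that
    \<open>sorted_list_of_multiset\<close> returns. The \<open>rev\<close> in
    \<open>gen_eigval_desc\<close> restores the order of \<open>d\<close>, and counting from 1
    becomes index \<open>j - 1\<close>.\<close>
  moreover have "sorted (rev (map d [0..<n]))"
    unfolding sorted_iff_nth_mono using anti by (auto simp: rev_nth)
  ultimately have "rev (sorted_list_of_multiset (image_mset Re (gen_eigvals A B))) = map d [0..<n]"
    by (simp only: sorted_list_of_multiset_mset sorted_sort_id rev_rev_ident)
  then show ?thesis
    unfolding gen_eigval_desc_def using j by simp
qed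

section \<open>Rayleigh quotients in coordinates and the dimension count\<close>

text \<open>\<open>Z* A Z\<close> is the matrix of the form in the coordinates \<open>x\<close>, so
  only its diagonal contributes. With \<open>B\<close> in place of \<open>A\<close> and all weights
  1, this also computes the denominator of the Rayleigh quotient.\<close>

lemma cscalar_prod_mat_diag:
  assumes Z: "Z \<in> carrier_mat n n" and A: "A \<in> carrier_mat n n" and x: "x \<in> carrier_vec n"
    and ZA: "mat_adjoint Z * A * Z = mat_diag n (\<lambda>i. complex_of_real (d i))"
  shows "(A *\<^sub>v (Z *\<^sub>v x)) \<bullet>c (Z *\<^sub>v x) = complex_of_real (\<Sum>i<n. d i * (cmod (x $ i))\<^sup>2)"
proof -
  have D: "mat_diag n (\<lambda>i. complex_of_real (d i)) *\<^sub>v x = vec n (\<lambda>i. complex_of_real (d i) * x $ i)"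
    using x by (intro eq_vecI) (auto simp: mat_diag_def scalar_prod_def if_distrib if_distribR cong: if_cong)
  show ?thesis
    unfolding cscalar_prod_congruence[OF Z A x x, symmetric] ZA D
    using x by (simp add: scalar_prod_def complex_norm_square lessThan_atLeast0 mult.assoc
      del: of_real_power)
qed

text \<open>Indices start at 0: there are \<open>j\<close> equations from rows of \<open>K\<close>
  and \<open>k - j - 1\<close> coordinates to annihilate, together \<open>k - 1\<close> homogeneous
  equations in \<open>k\<close> unknowns.\<close>

lemma ex_kernel_vec_supported_below:
  fixes K :: "'a :: field mat"
  assumes K: "K \<in> carrier_mat n k" and j: "j < k" "k \<le> n"
  obtains c where "c \<in> carrier_vec k" "c \<noteq> 0\<^sub>v k" "\<And>i. j < i \<Longrightarrow> i < k \<Longrightarrow> c $ i = 0"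
    "\<And>i. i < j \<Longrightarrow> (K *\<^sub>v c) $ i = 0"
proof -
  \<comment> \<open>The equations become the rows of a square matrix: rows of \<open>K\<close>
    before position \<open>j\<close>, unit vectors after it to read off coordinates. The zero row at
    \<open>j\<close> fills the gap and makes the determinant vanish.\<close>
  let ?f = "\<lambda>i. if i < j then row K i else unit_vec k i"
  let ?L = "mat\<^sub>r k k (\<lambda>i. if i = j then 0\<^sub>v k else ?f i)"
  have f: "?f \<in> {0..<k} \<rightarrow> carrier_vec k" using K by auto
  have L: "?L \<in> carrier_mat k k" by simp
  have "det ?L = 0" by (rule det_row_0[OF j(1) f])
  then obtain c where c: "c \<in> carrier_vec k" "c \<noteq> 0\<^sub>v k" "?L *\<^sub>v c = 0\<^sub>v k"
    unfolding det_0_iff_vec_prod_zero_field[OF L] by blast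
  have r: "(if i = j then 0\<^sub>v k else ?f i) \<bullet> c = 0" if i: "i < k" for i
  proof -
    have "(?L *\<^sub>v c) $ i = row ?L i \<bullet> c" using i by simp
    also have "row ?L i = (if i = j then 0\<^sub>v k else ?f i)"
      using i K j by (intro row_mat_of_row_fun) auto
    finally show ?thesis using c i by simp
  qed
  show thesis
  proof
    show "c $ i = 0" if "j < i" "i < k" for i
      using r[OF that(2)] that c by (simp add: scalar_prod_left_unit)
    show "(K *\<^sub>v c) $ i = 0" if "i < j" for i
      using r[of i] that j K by simp
  qed (use c in auto)
qed

theorem theorem4p17:
  fixes A B P :: "complex mat" and n k j :: nat
  assumes "A \<in> carrier_mat n n" and "B \<in> carrier_mat n n"
    and "hpd_mat A" and "hpd_mat B"
    and "P \<in> carrier_mat n k" and "k \<le> n"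
    and "vec_space.rank n P = k"
    and "1 \<le> j" and "j \<le> k"
  shows "gen_eigval_desc (mat_adjoint P * A * P) (mat_adjoint P * B * P) j
           \<le> gen_eigval_desc A B j"
proof -
  note A = assms(1) and B = assms(2) and P = assms(5)
  let ?A = "mat_adjoint P * A * P" and ?B = "mat_adjoint P * B * P"
  have A': "?A \<in> carrier_mat k k" and B': "?B \<in> carrier_mat k k"
    by (intro mult_carrier_mat[of _ k n] mat_adjoint_carrier A B P)+
  have hA: "hermitian_mat A" using assms(3) unfolding hpd_mat_def by simp
  have hA': "hermitian_mat ?A" by (rule hermitian_mat_congruence[OF P A hA])
  have hB': "hpd_mat ?B"
    using hpd_mat_congruence[OF P B assms(4)] rank_eq_dim_col_imp_inj[OF P assms(7)] by blast
  obtain Z d where Z: "Z \<in> carrier_mat n n" and ZB: "mat_adjoint Z * B * Z = 1\<^sub>m n"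
    and ZA: "mat_adjoint Z * A * Z = mat_diag n (\<lambda>i. complex_of_real (d i))"
    and d: "\<And>i j. i \<le> j \<Longrightarrow> j < n \<Longrightarrow> d j \<le> d i"
    using hpd_pencil_diagonalization[OF A B hA assms(4)] by blast
  obtain W f where W: "W \<in> carrier_mat k k" and WB: "mat_adjoint W * ?B * W = 1\<^sub>m k"
    and WA: "mat_adjoint W * ?A * W = mat_diag k (\<lambda>i. complex_of_real (f i))"
    and f: "\<And>i j. i \<le> j \<Longrightarrow> j < k \<Longrightarrow> f j \<le> f i"
    using hpd_pencil_diagonalization[OF A' B' hA' hB'] by blast
  \<comment> \<open>The identity is rewritten as a diagonal matrix with constant weight 1 so that
    \<open>cscalar_prod_mat_diag\<close> covers the forms of \<open>B\<close> and
    \<open>?B\<close>.\<close>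
  have ZB': "mat_adjoint Z * B * Z = mat_diag n (\<lambda>i. complex_of_real 1)"
    and WB': "mat_adjoint W * ?B * W = mat_diag k (\<lambda>i. complex_of_real 1)"
    using ZB WB by simp_all
  \<comment> \<open>\<open>Y\<close> is the inverse of \<open>Z\<close>; it sends a vector to its
    coordinates in the basis \<open>Z\<close>.\<close>
  define Y where "Y = mat_adjoint Z * B"
  have Y: "Y \<in> carrier_mat n n"
    unfolding Y_def by (rule mult_carrier_mat[OF mat_adjoint_carrier[OF Z] B])
  have ZY: "Z * Y = 1\<^sub>m n"
    unfolding Y_def by (rule mat_mult_left_right_inverse[OF Y[unfolded Y_def] Z ZB])
  have YPW: "Y * (P * W) \<in> carrier_mat n k"
    by (intro mult_carrier_mat[of _ n n] mult_carrier_mat[of _ n k] Y P W)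
  have jk: "j - 1 < k" using assms(8,9) by simp
  \<comment> \<open>Here \<open>c\<close> holds the coordinates of \<open>y = W c\<close>, and
    applying \<open>Y (P W)\<close> gives those of \<open>v = P y\<close>. Indexing from 0,
    \<open>c\<close> may be nonzero in its first \<open>j\<close> places, against
    \<open>j - 1\<close> equations.\<close>
  obtain c where c: "c \<in> carrier_vec k" "c \<noteq> 0\<^sub>v k" "\<And>i. j - 1 < i \<Longrightarrow> i < k \<Longrightarrow> c $ i = 0"
    and c0: "\<And>i. i < j - 1 \<Longrightarrow> ((Y * (P * W)) *\<^sub>v c) $ i = 0"
    using ex_kernel_vec_supported_below[OF YPW jk assms(6)] by blast
  define x where "x = (Y * (P * W)) *\<^sub>v c"
  have x: "x \<in> carrier_vec n" using YPW c unfolding x_def by simp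
  have "Z *\<^sub>v x = (Z * (Y * (P * W))) *\<^sub>v c"
    unfolding x_def using assoc_mult_mat_vec[OF Z YPW c(1)] by simp
  also have "Z * (Y * (P * W)) = P * W"
    using assoc_mult_mat[OF Z Y mult_carrier_mat[OF P W]] ZY
      left_mult_one_mat[OF mult_carrier_mat[OF P W]] by simp
  finally have Zx: "Z *\<^sub>v x = P *\<^sub>v (W *\<^sub>v c)"
    using assoc_mult_mat_vec[OF P W c(1)] by simp
  have Wc: "W *\<^sub>v c \<in> carrier_vec k" using W c by simp
  \<comment> \<open>Both coordinate systems describe the same \<open>v\<close>, so each form has two
    evaluations; these yield \<open>eqA\<close> and \<open>eqB\<close>.\<close>
  have form: "(C *\<^sub>v (Z *\<^sub>v x)) \<bullet>c (Z *\<^sub>v x)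
      = ((mat_adjoint P * C * P) *\<^sub>v (W *\<^sub>v c)) \<bullet>c (W *\<^sub>v c)"
    if "C \<in> carrier_mat n n" for C
    unfolding Zx using cscalar_prod_congruence[OF P that Wc Wc] by simp
  have eqA: "(\<Sum>i<n. d i * (cmod (x $ i))\<^sup>2) = (\<Sum>i<k. f i * (cmod (c $ i))\<^sup>2)"
    using form[OF A] unfolding cscalar_prod_mat_diag[OF Z A x ZA]
      cscalar_prod_mat_diag[OF W A' c(1) WA] of_real_eq_iff .
  have eqB: "(\<Sum>i<n. 1 * (cmod (x $ i))\<^sup>2) = (\<Sum>i<k. 1 * (cmod (c $ i))\<^sup>2)"
    using form[OF B] unfolding cscalar_prod_mat_diag[OF Z B x ZB']
      cscalar_prod_mat_diag[OF W B' c(1) WB'] of_real_eq_iff .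
  let ?S = "\<Sum>i<k. (cmod (c $ i))\<^sup>2"
  \<comment> \<open>On the support of \<open>c\<close> the weights are at least
    \<open>f (j - 1)\<close>; beyond it both sides vanish.\<close>
  have "f (j - 1) * ?S \<le> (\<Sum>i<k. f i * (cmod (c $ i))\<^sup>2)"
    unfolding sum_distrib_left
  proof (rule sum_mono)
    fix i assume "i \<in> {..<k}"
    then show "f (j - 1) * (cmod (c $ i))\<^sup>2 \<le> f i * (cmod (c $ i))\<^sup>2"
      using c(3)[of i] f[of i "j - 1"] jk by (cases "i \<le> j - 1") (auto intro: mult_right_mono)
  qed
  also have "\<dots> = (\<Sum>i<n. d i * (cmod (x $ i))\<^sup>2)" using eqA by simp
  \<comment> \<open>The coordinates of \<open>x\<close> before index \<open>j - 1\<close> vanish,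
    and from there on the weights are at most \<open>d (j - 1)\<close>.\<close>
  also have "\<dots> \<le> (\<Sum>i<n. d (j - 1) * (cmod (x $ i))\<^sup>2)"
  proof (rule sum_mono)
    fix i assume "i \<in> {..<n}"
    then show "d i * (cmod (x $ i))\<^sup>2 \<le> d (j - 1) * (cmod (x $ i))\<^sup>2"
      using c0[of i] d[of "j - 1" i]
      by (cases "i < j - 1") (auto simp: x_def[symmetric] intro: mult_right_mono)
  qed
  \<comment> \<open>The two squared B-norms agree, so both bounds carry the same factor
    \<open>?S\<close>, which is positive because \<open>c\<close> is nonzero and can be
    cancelled.\<close>
  also have "\<dots> = d (j - 1) * ?S" using eqB by (simp flip: sum_distrib_left)
  finally have le: "f (j - 1) * ?S \<le> d (j - 1) * ?S" .
  obtain i where "i < k" "c $ i \<noteq> 0"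
    using c by (metis carrier_vecD eq_vecI index_zero_vec(1) index_zero_vec(2))
  then have "0 < ?S" by (intro sum_pos2[of _ i]) auto
  then have "f (j - 1) \<le> d (j - 1)" using le by simp
  then show ?thesis
    using gen_eigval_desc_diagonalization[OF A B assms(4) Z ZB ZA d]
      gen_eigval_desc_diagonalization[OF A' B' hB' W WB WA f] assms(6,8,9) by simp
qed

end
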